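(* Let $t\ge 2$ and $k\ge 2$ be integers and let $H$ be a $k$-regular, $t$-uniform hypergraph (finite or infinite). Then $$\rho(H)\ \ge\ \frac{t}{t-1}\bigl((t-1)(k-1)\bigr)^{1/t}.$$
   Context: A hypergraph $H=(V,E)$ consists of a (nonempty, finite or countably infinite) vertex set $V=V(H)$ and a set $E=E(H)$ of subsets of $V$, called edges (no multiple edges). It is $t$-uniform if every edge has exactly $t$ vertices. The degree of a vertex $v$ is the number of edges containing $v$; infinite hypergraphs are assumed locally finite (every degree is finite). $H$ is $k$-regular if every vertex has degree $k$. The adjacency tensor of a $t$-uniform hypergraph $H$ is the order-$t$ symmetric tensor $\mathcal A=(\mathcal A_{v_1\cdots v_t})_{v_1,\dots,v_t\in V}$ with $\mathcal A_{v_1\cdots v_t}=\frac1{(t-1)!}$ if $\{v_1,\dots,v_t\}\in E$ and $0$ otherwise. For a tensor $\mathcal T$ of order $t$ over a finite set $U$ and $x\in\mathbb C^U$, let $(\mathcal Tx)_v=\sum_{v_2,\dots,v_t\in U}\mathcal T_{vv_2\cdots v_t}x_{v_2}\cdots x_{v_t}$. A number $\lambda\in\mathbb C$ is an eigenvalue of $\mathcal T$ if there is $0\ne x\in\mathbb C^U$ with $(\mathcal Tx)_v=\lambda x_v^{t-1}$ for all $v\in U$; the spectral radius $\rho(\mathcal T)$ of a nonnegative tensor $\mathcal T$ over a finite set is the maximum of $|\lambda|$ over its eigenvalues. If $\mathcal T$ is a nonnegative tensor over an infinite set $V$, then $\rho(\mathcal T)=\sup\{\rho(\mathcal T_U): U\subset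 V,\ U\text{ finite}\}$, where $\mathcal T_U$ is the restriction of $\mathcal T$ to $t$-tuples of elements of $U$. The spectral radius of $H$ is $\rho(H)=\rho(\mathcal A)$. For finite $H$ this agrees with $\rho(H)=\sup\{|\tau_H(x_1,\dots,x_t)| : x_i\in\mathbb C^V,\ \|x_i\|_t=1\}$, where $\tau_H$ is the $t$-linear form on $\mathbb C^V$ with coefficients $\mathcal A_{v_1\cdots v_t}$ in the standard basis and $\|x\|_t=(\sum_v|x_v|^t)^{1/t}$. *)

theory Defs
  imports Complex_Main "HOL-Library.Countable_Set" "HOL-Library.Extended_Real"
begin

locale hypergraph =
  fixes V :: "'a set" and E :: "'a set set"
  assumes nonempty: "V \<noteq> {}"
    and countable_vertices: "countable V"
    and edges_subset: "E \<subseteq> Pow V"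
    and locally_finite: "\<And>v. v \<in> V \<Longrightarrow> finite {e \<in> E. v \<in> e}"

definition uniform_hypergraph :: "nat \<Rightarrow> 'a set set \<Rightarrow> bool" where
  "uniform_hypergraph t E \<longleftrightarrow> (\<forall>e\<in>E. finite e \<and> card e = t)"

definition degree :: "'a set set \<Rightarrow> 'a \<Rightarrow> nat" where
  "degree E v = card {e \<in> E. v \<in> e}"

definition regular_hypergraph :: "nat \<Rightarrow> 'a set \<Rightarrow> 'a set set \<Rightarrow> bool" where
  "regular_hypergraph k V E \<longleftrightarrow> (\<forall>v\<in>V. degree E v = k)"

text \<open>
  A tensor of order \<open>t\<close> maps a list \<open>[v\<^sub>1, \<dots>, v\<^sub>t]\<close> of indices to an entry. Its values on lists
  of any other length, or on lists with members outside the index set, are never used; so the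
  restriction of a tensor to a smaller index set \<open>U\<close> is the same function, used with \<open>U\<close>.
\<close>
type_synonym 'a tensor = "'a list \<Rightarrow> complex"

definition adjacency_tensor :: "nat \<Rightarrow> 'a set set \<Rightarrow> 'a tensor" where
  "adjacency_tensor t E vs = (if length vs = t \<and> set vs \<in> E then 1 / fact (t - 1) else 0)"

definition tensor_apply :: "nat \<Rightarrow> 'a tensor \<Rightarrow> 'a set \<Rightarrow> ('a \<Rightarrow> complex) \<Rightarrow> 'a \<Rightarrow> complex" where
  "tensor_apply t T U x v =
     (\<Sum>vs | length vs = t - 1 \<and> set vs \<subseteq> U. T (v # vs) * prod_list (map x vs))"

text \<open>Only the values of \<open>x\<close> on \<open>U\<close> matter, so \<open>x\<close> stands for a vector indexed by \<open>U\<close>.\<close>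
definition tensor_eigenvalue :: "nat \<Rightarrow> 'a tensor \<Rightarrow> 'a set \<Rightarrow> complex \<Rightarrow> bool" where
  "tensor_eigenvalue t T U l \<longleftrightarrow>
     (\<exists>x. (\<exists>v\<in>U. x v \<noteq> 0) \<and> (\<forall>v\<in>U. tensor_apply t T U x v = l * x v ^ (t - 1)))"

definition finite_spectral_radius :: "nat \<Rightarrow> 'a tensor \<Rightarrow> 'a set \<Rightarrow> real" where
  "finite_spectral_radius t T U = (GREATEST r. \<exists>l. tensor_eigenvalue t T U l \<and> r = cmod l)"

text \<open>
  Extended reals, because the supremum over the finite subsets may be infinite for a general
  tensor. The empty index set is left out since over it there are no eigenvalues, so that the
  maximum would be unspecified.
\<close>
definition tensor_spectral_radius :: "nat \<Rightarrow> 'a tensor \<Rightarrow> 'a set \<Rightarrow> ereal" where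
  "tensor_spectral_radius t T V =
     (if finite V then ereal (finite_spectral_radius t T V)
      else (SUP U \<in> {U. U \<subseteq> V \<and> finite U \<and> U \<noteq> {}}. ereal (finite_spectral_radius t T U)))"

definition hypergraph_spectral_radius :: "nat \<Rightarrow> 'a set \<Rightarrow> 'a set set \<Rightarrow> ereal" where
  "hypergraph_spectral_radius t V E = tensor_spectral_radius t (adjacency_tensor t E) V"

end

theory Submission
  imports Defs "HOL-Analysis.Analysis" "HOL-Combinatorics.Multiset_Permutations"
begin

text \<open>
  Over a finite vertex set \<open>U\<close> the spectral radius of the adjacency tensor is the maximum \<open>\<mu>\<close> of the
  form \<open>x \<mapsto> \<Sum>\<^sub>v x\<^sub>v (\<A>x)\<^sub>v\<close> over the nonnegative vectors with \<open>\<Sum>\<^sub>v x\<^sub>v\<^sup>t = 1\<close>: a maximiser is an eigenvector,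
  by a Lagrange condition in each coordinate, and the moduli of any eigenvector for \<open>\<lambda>\<close> show that
  \<open>\<bar>\<lambda>\<bar> \<le> \<mu>\<close>. Consequently a nonnegative nonzero vector \<open>f\<close> with \<open>(\<A>f)\<^sub>v \<ge> c f\<^sub>v\<^sup>t\<^sup>-\<^sup>1\<close> at every \<open>v\<close>
  certifies that the spectral radius is at least \<open>c\<close> (\<open>finite_spectral_radius_ge_form\<close>).

  For each \<open>c\<close> below the claimed bound, such an \<open>f\<close> is found among the functions \<open>f(v) = \<phi>(d(v))\<close> of the
  distance \<open>d\<close> to a fixed vertex, with \<open>\<phi>\<close> decreasing. A vertex at distance \<open>i + 1\<close> lies in some edge
  containing a vertex at distance \<open>i\<close>, and its other \<open>k - 1\<close> edges reach distance \<open>i + 2\<close> at worst. The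
  hypertree is the worst case, so it suffices (\<open>radial_neighbour_sum_ge\<close>) that
  \<open>c \<phi>(i+1)\<^sup>t\<^sup>-\<^sup>1 \<le> \<phi>(i) \<phi>(i+1)\<^sup>t\<^sup>-\<^sup>2 + (k - 1) \<phi>(i+2)\<^sup>t\<^sup>-\<^sup>1\<close>, together with a condition at the root.

  In terms of the ratios \<open>r\<^sub>i = \<phi>(i+1) / \<phi>(i)\<close>, equality reads \<open>c = 1 / r\<^sub>i + (k - 1) r\<^sub>i\<^sub>+\<^sub>1\<^sup>t\<^sup>-\<^sup>1\<close>. The claimed
  bound is exactly the minimum of \<open>1 / r + (k - 1) r\<^sup>t\<^sup>-\<^sup>1\<close> over \<open>r > 0\<close> (\<open>critical_value_le\<close>). Below it the
  recursion has no fixed point, so \<open>r\<^sub>i\<^sup>t\<^sup>-\<^sup>1\<close> drops by a fixed amount at each step and \<open>\<phi>\<close> can be made to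
  vanish after finitely many steps (\<open>vanishing_profile\<close>). Then \<open>f\<close> is supported on a finite ball, and
  the argument covers finite and infinite hypergraphs, connected or not, at once.
\<close>

section \<open>The adjacency tensor in terms of edges\<close>

definition neighbour_sum :: "'a set set \<Rightarrow> 'a set \<Rightarrow> ('a \<Rightarrow> 'b::comm_semiring_1) \<Rightarrow> 'a \<Rightarrow> 'b" where
  "neighbour_sum E U x v = (\<Sum>e | e \<in> E \<and> v \<in> e \<and> e \<subseteq> U. \<Prod>u\<in>e - {v}. x u)"

definition edge_form :: "'a set set \<Rightarrow> 'a set \<Rightarrow> ('a \<Rightarrow> 'b::comm_semiring_1) \<Rightarrow> 'b" where
  "edge_form E U x = (\<Sum>e | e \<in> E \<and> e \<subseteq> U. \<Prod>u\<in>e. x u)"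

lemma uniform_hypergraphD:
  assumes "uniform_hypergraph t E" "e \<in> E"
  shows "finite e" "card e = t"
  using assms by (auto simp: uniform_hypergraph_def)

text \<open>
  An edge \<open>e\<close> through \<open>v\<close> has \<open>t\<close> elements, so the index lists that extend \<open>v\<close> to \<open>e\<close> are the orderings
  of \<open>e - {v}\<close>. There are \<open>(t - 1)!\<close> of them, which the normalisation of the tensor cancels.
\<close>

lemma tensor_apply_adjacency_tensor:
  assumes t: "t \<ge> 1" and unif: "uniform_hypergraph t E" and fin: "finite U" and v: "v \<in> U"
  shows "tensor_apply t (adjacency_tensor t E) U x v = neighbour_sum E U x v"
proof -
  let ?L = "{vs. length vs = t - 1 \<and> set vs \<subseteq> U}"
  let ?D = "{e. e \<in> E \<and> v \<in> e \<and> e \<subseteq> U}"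
  have finL: "finite ?L"
    using finite_lists_length_eq[OF fin, of "t - 1"] by (simp add: conj_commute)
  have finD: "finite ?D" by (rule finite_subset[of _ "Pow U"]) (use fin in auto)
  have cov: "{vs \<in> ?L. insert v (set vs) \<in> E} = (\<Union>e\<in>?D. permutations_of_set (e - {v}))"
  proof (intro equalityI subsetI)
    fix vs assume vs: "vs \<in> {vs \<in> ?L. insert v (set vs) \<in> E}"
    have c: "card (insert v (set vs)) = t" using vs unif by (auto simp: uniform_hypergraph_def)
    have len: "length vs = t - 1" using vs by auto
    have cl: "card (set vs) \<le> t - 1" using card_length[of vs] len by simp
    have nv: "v \<notin> set vs"
    proof
      assume "v \<in> set vs"
      then have "card (set vs) = t" using c by (simp add: insert_absorb)
      then show False using cl t by simp
    qed
    then have "distinct vs" using c len t by (intro card_distinct) auto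
    then have "vs \<in> permutations_of_set (insert v (set vs) - {v})"
      using nv by (simp add: permutations_of_set_def)
    moreover have "insert v (set vs) \<in> ?D" using vs v by auto
    ultimately show "vs \<in> (\<Union>e\<in>?D. permutations_of_set (e - {v}))" by blast
  next
    fix vs assume "vs \<in> (\<Union>e\<in>?D. permutations_of_set (e - {v}))"
    then obtain e where e: "e \<in> E" "v \<in> e" "e \<subseteq> U" "set vs = e - {v}" "distinct vs"
      by (auto simp: permutations_of_set_def)
    have "length vs = card (e - {v})" using e distinct_card[of vs] by simp
    also have "\<dots> = t - 1" using uniform_hypergraphD[OF unif e(1)] e(2) by simp
    finally show "vs \<in> {vs \<in> ?L. insert v (set vs) \<in> E}"
      using e by (auto simp: insert_absorb)
  qed
  have "tensor_apply t (adjacency_tensor t E) U x v =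
      (\<Sum>vs\<in>?L. if insert v (set vs) \<in> E then 1 / fact (t - 1) * prod_list (map x vs) else 0)"
    unfolding tensor_apply_def adjacency_tensor_def
    by (intro sum.cong) (use t in auto)
  also have "\<dots> = (\<Sum>vs\<in>{vs \<in> ?L. insert v (set vs) \<in> E}. 1 / fact (t - 1) * prod_list (map x vs))"
    by (rule sum.inter_filter[symmetric, OF finL])
  also have "\<dots> = (\<Sum>e\<in>?D. \<Sum>vs\<in>permutations_of_set (e - {v}). 1 / fact (t - 1) * prod_list (map x vs))"
    unfolding cov
  proof (rule sum.UNION_disjoint[OF finD])
    show "\<forall>e\<in>?D. finite (permutations_of_set (e - {v}))" by simp
    show "\<forall>e\<in>?D. \<forall>e'\<in>?D. e \<noteq> e' \<longrightarrow>
        permutations_of_set (e - {v}) \<inter> permutations_of_set (e' - {v}) = {}"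
      by (auto simp: permutations_of_set_def)
  qed
  also have "\<dots> = (\<Sum>e\<in>?D. \<Prod>u\<in>e - {v}. x u)"
  proof (rule sum.cong[OF refl])
    fix e assume e: "e \<in> ?D"
    have fe: "finite (e - {v})" and ce: "card (e - {v}) = t - 1"
      using uniform_hypergraphD[OF unif, of e] e by auto
    have "(\<Sum>vs\<in>permutations_of_set (e - {v}). 1 / fact (t - 1) * prod_list (map x vs))
        = (\<Sum>vs\<in>permutations_of_set (e - {v}). 1 / fact (t - 1) * (\<Prod>u\<in>e - {v}. x u))"
    proof (rule sum.cong[OF refl])
      fix vs assume "vs \<in> permutations_of_set (e - {v})"
      then have "set vs = e - {v}" "distinct vs" by (auto simp: permutations_of_set_def)
      then show "1 / fact (t - 1) * prod_list (map x vs) = 1 / fact (t - 1) * (\<Prod>u\<in>e - {v}. x u)"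
        using prod.distinct_set_conv_list[of vs x] by simp
    qed
    also have "\<dots> = (\<Prod>u\<in>e - {v}. x u)" using fe ce by simp
    finally show "(\<Sum>vs\<in>permutations_of_set (e - {v}). 1 / fact (t - 1) * prod_list (map x vs))
        = (\<Prod>u\<in>e - {v}. x u)" .
  qed
  finally show ?thesis by (simp add: neighbour_sum_def)
qed

lemma sum_neighbour_sum_eq_edge_form:
  fixes x :: "'a \<Rightarrow> 'b::comm_semiring_1"
  assumes unif: "uniform_hypergraph t E" and fin: "finite U"
  shows "(\<Sum>v\<in>U. x v * neighbour_sum E U x v) = of_nat t * edge_form E U x"
proof -
  let ?D = "{e. e \<in> E \<and> e \<subseteq> U}"
  have finD: "finite ?D" by (rule finite_subset[of _ "Pow U"]) (use fin in auto)
  have "(\<Sum>v\<in>U. x v * neighbour_sum E U x v)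
      = (\<Sum>v\<in>U. \<Sum>e\<in>{e \<in> ?D. v \<in> e}. \<Prod>u\<in>e. x u)"
  proof (rule sum.cong[OF refl])
    fix v assume "v \<in> U"
    have "x v * neighbour_sum E U x v = (\<Sum>e\<in>{e \<in> ?D. v \<in> e}. x v * (\<Prod>u\<in>e - {v}. x u))"
      unfolding neighbour_sum_def sum_distrib_left by (rule sum.cong) auto
    also have "\<dots> = (\<Sum>e\<in>{e \<in> ?D. v \<in> e}. \<Prod>u\<in>e. x u)"
      by (rule sum.cong[OF refl], subst prod.remove) (auto intro: uniform_hypergraphD[OF unif])
    finally show "x v * neighbour_sum E U x v = (\<Sum>e\<in>{e \<in> ?D. v \<in> e}. \<Prod>u\<in>e. x u)" .
  qed
  also have "\<dots> = (\<Sum>e\<in>?D. \<Sum>v\<in>{v \<in> U. v \<in> e}. \<Prod>u\<in>e. x u)"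
    by (rule sum.swap_restrict[OF fin finD])
  also have "\<dots> = (\<Sum>e\<in>?D. of_nat t * (\<Prod>u\<in>e. x u))"
  proof (rule sum.cong[OF refl])
    fix e assume e: "e \<in> ?D"
    then have "{v \<in> U. v \<in> e} = e" by auto
    then show "(\<Sum>v\<in>{v \<in> U. v \<in> e}. \<Prod>u\<in>e. x u) = of_nat t * (\<Prod>u\<in>e. x u)"
      using uniform_hypergraphD[OF unif, of e] e by simp
  qed
  finally show ?thesis by (simp add: edge_form_def sum_distrib_left)
qed

text \<open>
  The form is affine in each coordinate, with slope \<^const>\<open>neighbour_sum\<close>; this serves as its partial
  derivative in the Lagrange condition.
\<close>

lemma edge_form_fun_upd:
  fixes x :: "'a \<Rightarrow> 'b::comm_semiring_1"
  assumes unif: "uniform_hypergraph t E" and fin: "finite U"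
  shows "edge_form E U (x(v := s)) = s * neighbour_sum E U x v + edge_form E (U - {v}) x"
proof -
  let ?A = "{e. e \<in> E \<and> v \<in> e \<and> e \<subseteq> U}" and ?B = "{e. e \<in> E \<and> e \<subseteq> U - {v}}"
  have fins: "finite ?A" "finite ?B"
    by (rule finite_subset[of _ "Pow U"]; use fin in auto)+
  have "edge_form E U (x(v := s)) = (\<Sum>e\<in>?A \<union> ?B. \<Prod>u\<in>e. (x(v := s)) u)"
    unfolding edge_form_def by (rule sum.cong) auto
  also have "\<dots> = (\<Sum>e\<in>?A. \<Prod>u\<in>e. (x(v := s)) u) + (\<Sum>e\<in>?B. \<Prod>u\<in>e. (x(v := s)) u)"
    by (rule sum.union_disjoint) (use fins in auto)
  also have "(\<Sum>e\<in>?A. \<Prod>u\<in>e. (x(v := s)) u) = (\<Sum>e\<in>?A. s * (\<Prod>u\<in>e - {v}. x u))"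
  proof (rule sum.cong[OF refl])
    fix e assume e: "e \<in> ?A"
    then have "(\<Prod>u\<in>e. (x(v := s)) u) = (x(v := s)) v * (\<Prod>u\<in>e - {v}. (x(v := s)) u)"
      by (intro prod.remove) (auto intro: uniform_hypergraphD[OF unif])
    also have "(\<Prod>u\<in>e - {v}. (x(v := s)) u) = (\<Prod>u\<in>e - {v}. x u)"
      by (rule prod.cong) auto
    finally show "(\<Prod>u\<in>e. (x(v := s)) u) = s * (\<Prod>u\<in>e - {v}. x u)" by simp
  qed
  also have "\<dots> = s * neighbour_sum E U x v" by (simp add: neighbour_sum_def sum_distrib_left)
  also have "(\<Sum>e\<in>?B. \<Prod>u\<in>e. (x(v := s)) u) = edge_form E (U - {v}) x"
    unfolding edge_form_def by (intro sum.cong prod.cong) auto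
  finally show ?thesis .
qed

lemma edge_form_scale:
  fixes x :: "'a \<Rightarrow> 'b::comm_semiring_1"
  assumes unif: "uniform_hypergraph t E"
  shows "edge_form E U (\<lambda>u. c * x u) = c ^ t * edge_form E U x"
  unfolding edge_form_def sum_distrib_left
  by (rule sum.cong) (auto simp: prod.distrib uniform_hypergraphD[OF unif])

lemma edge_form_cong: "(\<And>u. u \<in> U \<Longrightarrow> x u = y u) \<Longrightarrow> edge_form E U x = edge_form E U y"
  unfolding edge_form_def by (intro sum.cong prod.cong) auto

lemma neighbour_sum_nonneg:
  fixes x :: "'a \<Rightarrow> real"
  assumes "\<And>u. u \<in> U \<Longrightarrow> x u \<ge> 0"
  shows "neighbour_sum E U x v \<ge> 0"
  unfolding neighbour_sum_def by (intro sum_nonneg prod_nonneg) (use assms in auto)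

lemma edge_form_nonneg:
  fixes x :: "'a \<Rightarrow> real"
  assumes "\<And>u. u \<in> U \<Longrightarrow> x u \<ge> 0"
  shows "edge_form E U x \<ge> 0"
  unfolding edge_form_def by (intro sum_nonneg prod_nonneg) (use assms in auto)

lemma neighbour_sum_of_real:
  "neighbour_sum E U (\<lambda>u. complex_of_real (x u)) v = complex_of_real (neighbour_sum E U x v)"
  by (simp add: neighbour_sum_def)

lemma norm_neighbour_sum_le:
  "cmod (neighbour_sum E U x v) \<le> neighbour_sum E U (\<lambda>u. cmod (x u)) v"
  unfolding neighbour_sum_def by (rule order_trans[OF norm_sum]) (simp add: prod_norm)

section \<open>The spectral radius as the maximum of a form\<close>

text \<open>
  The nonnegative unit vectors for the \<open>t\<close>-norm, extended by 0 outside \<open>U\<close>, form a compact set in the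
  product topology, by Tychonoff's theorem. The inequality for all nonnegative \<open>y\<close> follows from the one
  for unit vectors because both sides are homogeneous of degree \<open>t\<close>; stating it so avoids any
  normalisation where it is used.
\<close>

lemma edge_form_attains_max:
  assumes t: "t \<ge> 1" and unif: "uniform_hypergraph t E" and fin: "finite U" and ne: "U \<noteq> {}"
  obtains x :: "'a \<Rightarrow> real" where "\<And>u. x u \<ge> 0" "(\<Sum>u\<in>U. x u ^ t) = 1"
    "\<And>y. (\<And>u. u \<in> U \<Longrightarrow> y u \<ge> 0) \<Longrightarrow> edge_form E U y \<le> edge_form E U x * (\<Sum>u\<in>U. y u ^ t)"
proof -
  let ?B = "PiE UNIV (\<lambda>u. if u \<in> U then {0..1::real} else {0})"
  let ?S = "{x :: 'a \<Rightarrow> real. (\<Sum>u\<in>U. x u ^ t) = 1}"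
  have coord: "continuous_on A (\<lambda>x::'a \<Rightarrow> real. x u)" for A u
    by (rule continuous_on_subset[OF continuous_on_product_coordinates]) simp
  have "compactin (product_topology (\<lambda>_::'a. euclidean :: real topology) UNIV) ?B"
  proof (rule iffD2[OF compactin_PiE], intro disjI2 ballI)
    fix u
    show "compactin euclidean (if u \<in> U then {0..1::real} else {0})"
      unfolding compactin_euclidean_iff by (cases "u \<in> U") simp_all
  qed
  then have "compact ?B" by (simp only: euclidean_product_topology compactin_euclidean_iff)
  moreover have "closed ?S"
  proof (rule closed_Collect_eq)
    show "continuous_on UNIV (\<lambda>x::'a \<Rightarrow> real. \<Sum>u\<in>U. x u ^ t)"
      by (rule continuous_on_sum, rule continuous_on_power, rule coord)
  qed (rule continuous_on_const)
  ultimately have comp: "compact (?B \<inter> ?S)" by (rule compact_Int_closed)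
  obtain u0 where u0: "u0 \<in> U" using ne by blast
  have "(\<Sum>u\<in>U. (if u = u0 then 1 else 0::real) ^ t) = (\<Sum>u\<in>U. if u = u0 then 1 else 0)"
    by (rule sum.cong) (use t in auto)
  also have "\<dots> = 1" using u0 fin by simp
  finally have "(\<lambda>u. if u = u0 then 1 else 0) \<in> ?B \<inter> ?S" using u0 by auto
  then have "?B \<inter> ?S \<noteq> {}" by blast
  moreover have "continuous_on (?B \<inter> ?S) (edge_form E U)"
    unfolding edge_form_def by (intro continuous_on_sum continuous_on_prod coord)
  ultimately have "\<exists>x\<in>?B \<inter> ?S. \<forall>y\<in>?B \<inter> ?S. edge_form E U y \<le> edge_form E U x"
    by (rule continuous_attains_sup[OF comp])
  then obtain x where x: "x \<in> ?B \<inter> ?S" and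
      mx: "\<forall>y\<in>?B \<inter> ?S. edge_form E U y \<le> edge_form E U x" ..
  show thesis
  proof (rule that)
    show "x u \<ge> 0" for u
    proof -
      have "x u \<in> (if u \<in> U then {0..1} else {0})" using x by (intro PiE_mem[of x UNIV]) auto
      then show ?thesis by (auto split: if_splits)
    qed
    show "(\<Sum>u\<in>U. x u ^ t) = 1" using x by auto
    fix y :: "'a \<Rightarrow> real" assume y: "\<And>u. u \<in> U \<Longrightarrow> y u \<ge> 0"
    define s where "s = (\<Sum>u\<in>U. y u ^ t)"
    have s0: "s \<ge> 0" unfolding s_def by (intro sum_nonneg) (use y in auto)
    define c where "c = root t s"
    have ct: "c ^ t = s" using s0 t by (simp add: c_def real_root_pow_pos2)
    have c0: "c \<ge> 0" using s0 by (simp add: c_def real_root_ge_zero)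
    have yc: "y u \<le> c" if "u \<in> U" for u
    proof -
      have "y u ^ t \<le> s" unfolding s_def
        by (rule member_le_sum) (use that y fin in auto)
      then show ?thesis using ct c0 y[OF that] t by (metis power_mono_iff zero_less_iff_neq_zero not_one_le_zero)
    qed
    define z where "z = (\<lambda>u. if u \<in> U then y u / c else 0)"
    have eqy: "edge_form E U y = s * edge_form E U z"
    proof -
      have "y u = c * z u" if "u \<in> U" for u
        using yc[OF that] y[OF that] that by (cases "c = 0") (auto simp: z_def)
      then have "edge_form E U y = edge_form E U (\<lambda>u. c * z u)" by (rule edge_form_cong)
      then show ?thesis by (simp add: edge_form_scale[OF unif] ct)
    qed
    show "edge_form E U y \<le> edge_form E U x * (\<Sum>u\<in>U. y u ^ t)"
    proof (cases "s = 0")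
      case True
      then show ?thesis using eqy by (simp add: s_def)
    next
      case False
      then have cpos: "c > 0" using c0 ct t by (cases "c = 0") auto
      have "z \<in> ?B" using yc y cpos by (auto simp: z_def)
      moreover have "(\<Sum>u\<in>U. z u ^ t) = (\<Sum>u\<in>U. y u ^ t / s)"
        by (rule sum.cong) (auto simp: z_def power_divide ct)
      then have "(\<Sum>u\<in>U. z u ^ t) = 1"
        using False by (simp add: s_def flip: sum_divide_distrib)
      ultimately have "edge_form E U z \<le> edge_form E U x" using mx by auto
      then show ?thesis unfolding eqy s_def[symmetric]
        using s0 by (simp add: mult.commute mult_left_mono)
    qed
  qed
qed

text \<open>
  The Lagrange condition in one coordinate. At an interior minimum the derivative vanishes. At the
  boundary point 0 it is one-sided, and \<open>b\<close> must vanish because the power, of exponent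
  at least 2, cannot compensate a linear gain near 0.
\<close>

lemma min_power_minus_linear_stationary:
  fixes \<mu> b s0 :: real
  assumes t: "t \<ge> 2" and \<mu>: "\<mu> \<ge> 0" and b: "b \<ge> 0" and s0: "s0 \<ge> 0"
    and mn: "\<And>s. s \<ge> 0 \<Longrightarrow> \<mu> * s0 ^ t - real t * b * s0 \<le> \<mu> * s ^ t - real t * b * s"
  shows "b = \<mu> * s0 ^ (t - 1)"
proof (cases "s0 = 0")
  case False
  then have pos: "s0 > 0" using s0 by simp
  have "((\<lambda>s. \<mu> * s ^ t - real t * b * s) has_real_derivative
      (\<mu> * (real t * s0 ^ (t - 1)) - real t * b)) (at s0)"
    by (auto intro!: derivative_eq_intros)
  then have "\<mu> * (real t * s0 ^ (t - 1)) - real t * b = 0"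
    by (rule DERIV_local_min[where d = s0]) (use pos in \<open>auto intro!: mn\<close>)
  then have "real t * (\<mu> * s0 ^ (t - 1) - b) = 0" by (simp add: algebra_simps)
  then show ?thesis using t by simp
next
  case True
  have "b \<le> 0"
  proof (rule ccontr)
    assume "\<not> b \<le> 0"
    then have bpos: "b > 0" by simp
    \<comment> \<open>small enough that the linear term \<open>t b s\<close> exceeds \<open>\<mu> s\<^sup>2\<close>\<close>
    define s where "s = min 1 (b / (\<mu> + 1))"
    have s: "s > 0" "s \<le> 1" "s \<le> b / (\<mu> + 1)" using bpos \<mu> by (auto simp: s_def)
    have "real t * b * s \<le> \<mu> * s ^ t" using mn[of s] s True t by (simp add: power_0_left)
    also have "s ^ t \<le> s ^ 2" using s t by (intro power_decreasing) auto
    then have "\<mu> * s ^ t \<le> \<mu> * s ^ 2" using \<mu> by (rule mult_left_mono)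
    finally have "real t * b \<le> \<mu> * s" using s by (simp add: power2_eq_square)
    also have "\<dots> \<le> \<mu> * (b / (\<mu> + 1))" using s \<mu> by (intro mult_left_mono) auto
    also have "\<dots> < b" using \<mu> bpos by (simp add: field_simps)
    also have "\<dots> \<le> real t * b" using t bpos by simp
    finally show False by simp
  qed
  then show ?thesis using b True t by simp
qed

text \<open>
  The maximum \<open>\<mu>\<close> of the form is the largest modulus of an eigenvalue. Summing the pointwise
  inequality for \<open>f\<close> with weights \<open>f v\<close> bounds \<open>c\<close> by \<open>\<mu>\<close>. The same computation applied to the moduli
  of a complex eigenvector shows that no eigenvalue exceeds \<open>\<mu>\<close> in modulus.
\<close>

lemma finite_spectral_radius_ge_form:
  fixes f :: "'a \<Rightarrow> real"
  assumes t: "t \<ge> 2" and unif: "uniform_hypergraph t E" and fin: "finite U"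
    and f0: "\<And>u. u \<in> U \<Longrightarrow> f u \<ge> 0" and fpos: "w \<in> U" "f w > 0"
    and sub: "\<And>v. v \<in> U \<Longrightarrow> neighbour_sum E U f v \<ge> c * f v ^ (t - 1)"
  shows "finite_spectral_radius t (adjacency_tensor t E) U \<ge> c"
proof -
  have t1: "t \<ge> 1" using t by simp
  have pw: "a * a ^ (t - 1) = a ^ t" for a :: real
    using t1 by (simp add: power_eq_if)
  obtain x :: "'a \<Rightarrow> real" where x: "\<And>u. x u \<ge> 0" "(\<Sum>u\<in>U. x u ^ t) = 1" and
    mx: "\<And>y. (\<And>u. u \<in> U \<Longrightarrow> y u \<ge> 0) \<Longrightarrow> edge_form E U y \<le> edge_form E U x * (\<Sum>u\<in>U. y u ^ t)"
    using edge_form_attains_max[OF t1 unif fin] fpos by blast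
  define \<mu> where "\<mu> = real t * edge_form E U x"
  have \<mu>0: "\<mu> \<ge> 0" unfolding \<mu>_def using edge_form_nonneg[of U x E] x by simp
  have bound: "(\<Sum>v\<in>U. y v * neighbour_sum E U y v) \<le> \<mu> * (\<Sum>u\<in>U. y u ^ t)"
    if "\<And>u. u \<in> U \<Longrightarrow> y u \<ge> 0" for y :: "'a \<Rightarrow> real"
    using mx[of y] that unfolding sum_neighbour_sum_eq_edge_form[OF unif fin] \<mu>_def
    by (simp add: mult.assoc mult_left_mono)
  \<comment> \<open>used for \<open>f\<close> itself and for the moduli of an arbitrary eigenvector\<close>
  have le_mu: "c \<le> \<mu>" if y: "\<And>u. u \<in> U \<Longrightarrow> y u \<ge> 0" and w: "w \<in> U" "y w > 0"
    and ns: "\<And>v. v \<in> U \<Longrightarrow> c * y v ^ (t - 1) \<le> neighbour_sum E U y v"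
    for y :: "'a \<Rightarrow> real" and c w
  proof -
    have "c * (\<Sum>u\<in>U. y u ^ t) = (\<Sum>u\<in>U. y u * (c * y u ^ (t - 1)))"
      unfolding sum_distrib_left by (rule sum.cong) (simp_all add: mult.left_commute pw del: One_nat_def)
    also have "\<dots> \<le> (\<Sum>v\<in>U. y v * neighbour_sum E U y v)"
      by (intro sum_mono mult_left_mono ns y)
    also have "\<dots> \<le> \<mu> * (\<Sum>u\<in>U. y u ^ t)" by (rule bound) (rule y)
    finally have "c * (\<Sum>u\<in>U. y u ^ t) \<le> \<mu> * (\<Sum>u\<in>U. y u ^ t)" .
    moreover have "(\<Sum>u\<in>U. y u ^ t) > 0"
      by (rule sum_pos2[OF fin w(1)]) (use y w in auto)
    ultimately show ?thesis by simp
  qed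
  have eig: "neighbour_sum E U x v = \<mu> * x v ^ (t - 1)" if v: "v \<in> U" for v
  proof (rule min_power_minus_linear_stationary[OF t \<mu>0])
    show "neighbour_sum E U x v \<ge> 0" using x by (intro neighbour_sum_nonneg)
    show "x v \<ge> 0" by (rule x)
    fix s :: real assume s: "s \<ge> 0"
    \<comment> \<open>vary the maximiser in the coordinate \<open>v\<close> only\<close>
    have P: "(\<Sum>u\<in>U. (x(v := s)) u ^ t) = s ^ t + (\<Sum>u\<in>U - {v}. x u ^ t)" for s
      by (subst sum.remove[OF fin v]) (auto intro!: sum.cong)
    note F = edge_form_fun_upd[OF unif fin, of x v]
    have "edge_form E U (x(v := s)) \<le> edge_form E U x * (\<Sum>u\<in>U. (x(v := s)) u ^ t)"
      by (rule mx) (use s x in auto)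
    then have "real t * edge_form E U (x(v := s)) \<le> \<mu> * (\<Sum>u\<in>U. (x(v := s)) u ^ t)"
      unfolding \<mu>_def by (simp only: mult.assoc mult_left_mono of_nat_0_le_iff)
    moreover have "real t * edge_form E U (x(v := x v)) = \<mu> * (\<Sum>u\<in>U. (x(v := x v)) u ^ t)"
      using x by (simp add: \<mu>_def)
    ultimately show "\<mu> * x v ^ t - real t * neighbour_sum E U x v * x v
        \<le> \<mu> * s ^ t - real t * neighbour_sum E U x v * s"
      unfolding P F by (simp add: algebra_simps)
  qed
  have "finite_spectral_radius t (adjacency_tensor t E) U = \<mu>"
    unfolding finite_spectral_radius_def
  proof (rule Greatest_equality)
    have "\<exists>v\<in>U. x v \<noteq> 0"
    proof (rule ccontr)
      assume "\<not> ?thesis"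
      then have "(\<Sum>u\<in>U. x u ^ t) = 0" using t1 by auto
      then show False using x by simp
    qed
    then have "tensor_eigenvalue t (adjacency_tensor t E) U (complex_of_real \<mu>)"
      unfolding tensor_eigenvalue_def
      by (intro exI[of _ "\<lambda>u. complex_of_real (x u)"])
        (auto simp: tensor_apply_adjacency_tensor[OF t1 unif fin] neighbour_sum_of_real eig)
    then show "\<exists>l. tensor_eigenvalue t (adjacency_tensor t E) U l \<and> \<mu> = cmod l"
      using \<mu>0 by (intro exI[of _ "complex_of_real \<mu>"]) simp
  next
    fix r assume "\<exists>l. tensor_eigenvalue t (adjacency_tensor t E) U l \<and> r = cmod l"
    then obtain l z w where r: "r = cmod l" and w: "w \<in> U" "z w \<noteq> 0"
      and z: "\<And>v. v \<in> U \<Longrightarrow> neighbour_sum E U z v = l * z v ^ (t - 1)"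
      unfolding tensor_eigenvalue_def
      by (auto simp: tensor_apply_adjacency_tensor[OF t1 unif fin])
    show "r \<le> \<mu>"
    proof (rule le_mu[of "\<lambda>u. cmod (z u)" w])
      fix v assume v: "v \<in> U"
      show "r * cmod (z v) ^ (t - 1) \<le> neighbour_sum E U (\<lambda>u. cmod (z u)) v"
        using norm_neighbour_sum_le[of E U z v] z[OF v] by (simp add: r norm_mult norm_power)
    qed (use w in auto)
  qed
  moreover have "c \<le> \<mu>" by (rule le_mu[of f w]) (use f0 fpos sub in auto)
  ultimately show ?thesis by simp
qed

section \<open>Radial functions around a vertex\<close>

primrec edge_ball :: "'a set set \<Rightarrow> 'a \<Rightarrow> nat \<Rightarrow> 'a set" where
  "edge_ball E v 0 = {v}"
| "edge_ball E v (Suc n) = edge_ball E v n \<union> \<Union>{e \<in> E. e \<inter> edge_ball E v n \<noteq> {}}"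

lemma edge_ball_mono: "m \<le> n \<Longrightarrow> edge_ball E v m \<subseteq> edge_ball E v n"
  by (rule lift_Suc_mono_le) auto

lemma edge_subset_edge_ball:
  assumes "e \<in> E" "w \<in> e" "w \<in> edge_ball E v n"
  shows "e \<subseteq> edge_ball E v (Suc n)"
  using assms by auto

lemma edge_ball_finite_subset:
  assumes H: "hypergraph V E" and fe: "\<And>e. e \<in> E \<Longrightarrow> finite e" and v: "v \<in> V"
  shows "finite (edge_ball E v n) \<and> edge_ball E v n \<subseteq> V"
proof (induction n)
  case (Suc n)
  interpret hypergraph V E by (rule H)
  have "{e \<in> E. e \<inter> edge_ball E v n \<noteq> {}} = (\<Union>w\<in>edge_ball E v n. {e \<in> E. w \<in> e})" by auto
  moreover have "finite \<dots>" using Suc locally_finite by auto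
  ultimately have "finite {e \<in> E. e \<inter> edge_ball E v n \<noteq> {}}" by simp
  then show ?case using Suc fe edges_subset by auto
qed (use v in auto)

text \<open>
  The least \<open>n\<close> with \<open>u\<close> in the ball of radius \<open>n\<close> is the distance from \<open>v\<close> to \<open>u\<close>. Vertices in other
  components get the value 0, as if at infinite distance.
\<close>

definition radial :: "(nat \<Rightarrow> real) \<Rightarrow> 'a set set \<Rightarrow> 'a \<Rightarrow> 'a \<Rightarrow> real" where
  "radial \<phi> E v u =
     (if \<exists>n. u \<in> edge_ball E v n then \<phi> (LEAST n. u \<in> edge_ball E v n) else 0)"

lemma radial_nonneg: "(\<And>n. \<phi> n \<ge> 0) \<Longrightarrow> radial \<phi> E v u \<ge> 0"
  by (simp add: radial_def)

lemma radial_ge: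
  assumes "antimono \<phi>" "u \<in> edge_ball E v n"
  shows "radial \<phi> E v u \<ge> \<phi> n"
proof -
  have "\<phi> n \<le> \<phi> (LEAST n. u \<in> edge_ball E v n)"
    by (rule antimonoD[OF assms(1) Least_le]) (rule assms(2))
  then show ?thesis using assms(2) by (auto simp: radial_def)
qed

lemma radial_eq_0:
  assumes "antimono \<phi>" "\<And>n. \<phi> n \<ge> 0" "\<phi> N = 0" "u \<notin> edge_ball E v N"
  shows "radial \<phi> E v u = 0"
proof (cases "\<exists>n. u \<in> edge_ball E v n")
  case True
  define l where "l = (LEAST n. u \<in> edge_ball E v n)"
  have "u \<in> edge_ball E v l" unfolding l_def using True by (rule LeastI_ex)
  then have "\<not> l \<le> N" using edge_ball_mono[of l N E v] assms(4) by auto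
  then have "\<phi> l \<le> \<phi> N" by (intro antimonoD[OF assms(1)]) simp
  then show ?thesis using assms(2)[of l] assms(3) True by (simp add: radial_def l_def)
qed (simp add: radial_def)

lemma power_card_le_prod:
  fixes f :: "'a \<Rightarrow> real"
  assumes "a \<ge> 0" "\<And>u. u \<in> A \<Longrightarrow> a \<le> f u"
  shows "a ^ card A \<le> prod f A"
proof -
  have "(\<Prod>u\<in>A. a) \<le> prod f A" by (rule prod_mono) (use assms in auto)
  then show ?thesis by simp
qed

text \<open>
  Since \<open>\<phi>\<close> decreases, bounding the distances of the neighbours of \<open>v\<close> from above bounds the sum from
  below. In the hypertree every edge has one vertex closer to the root than the others, and there the
  bound is an equality.
\<close>

lemma radial_neighbour_sum_ge:
  assumes H: "hypergraph V E" and t: "t \<ge> 2" and k: "k \<ge> 1"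
    and unif: "uniform_hypergraph t E" and reg: "regular_hypergraph k V E"
    and anti: "antimono \<phi>" and nonneg: "\<And>n. \<phi> n \<ge> 0" and \<phi>N: "\<phi> N = 0"
    and root: "c * \<phi> 0 ^ (t - 1) \<le> real k * \<phi> 1 ^ (t - 1)"
    and level: "\<And>i. c * \<phi> (Suc i) ^ (t - 1)
        \<le> \<phi> i * \<phi> (Suc i) ^ (t - 2) + (real k - 1) * \<phi> (Suc (Suc i)) ^ (t - 1)"
    and U: "edge_ball E v0 N \<subseteq> U" "U \<subseteq> V" and v: "v \<in> U"
  shows "neighbour_sum E U (radial \<phi> E v0) v \<ge> c * radial \<phi> E v0 v ^ (t - 1)"
proof -
  interpret hypergraph V E by (rule H)
  let ?f = "radial \<phi> E v0" and ?D = "{e \<in> E. v \<in> e}"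
  have f0: "?f u \<ge> 0" for u by (rule radial_nonneg[OF nonneg])
  have vV: "v \<in> V" using v U by auto
  have finD: "finite ?D" by (rule locally_finite[OF vV])
  have cardD: "card ?D = k" using reg vV by (simp add: regular_hypergraph_def Defs.degree_def)
  have fin: "finite (e - {v})" and card: "card (e - {v}) = t - 1" if "e \<in> ?D" for e
    using uniform_hypergraphD[OF unif, of e] that by auto
  \<comment> \<open>an edge that leaves \<open>U\<close> contains a vertex outside the support of \<open>f\<close>, so it contributes 0\<close>
  have ns: "neighbour_sum E U ?f v = (\<Sum>e\<in>?D. \<Prod>u\<in>e - {v}. ?f u)"
    unfolding neighbour_sum_def
  proof (rule sum.mono_neutral_left[OF finD])
    show "\<forall>e\<in>?D - {e. e \<in> E \<and> v \<in> e \<and> e \<subseteq> U}. (\<Prod>u\<in>e - {v}. ?f u) = 0"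
    proof
      fix e assume e: "e \<in> ?D - {e. e \<in> E \<and> v \<in> e \<and> e \<subseteq> U}"
      then obtain u where u: "u \<in> e" "u \<notin> U" by auto
      then have "?f u = 0" using U by (intro radial_eq_0[OF anti nonneg \<phi>N]) auto
      moreover have "u \<in> e - {v}" using u v by auto
      ultimately show "(\<Prod>u\<in>e - {v}. ?f u) = 0" using e fin[of e] by (auto simp: prod_zero_iff)
    qed
  qed auto
  have far: "(\<Prod>u\<in>e - {v}. ?f u) \<ge> \<phi> (Suc n) ^ (t - 1)"
    if e: "e \<in> ?D" and vn: "v \<in> edge_ball E v0 n" for e n
    unfolding card[OF e, symmetric]
  proof (rule power_card_le_prod[OF nonneg])
    fix u assume "u \<in> e - {v}"
    then have "u \<in> edge_ball E v0 (Suc n)" using edge_subset_edge_ball[of e E v v0 n] e vn by auto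
    then show "\<phi> (Suc n) \<le> ?f u" by (rule radial_ge[OF anti])
  qed
  show ?thesis
  proof (cases "\<exists>n. v \<in> edge_ball E v0 n")
    case False
    then have "?f v = 0" by (simp add: radial_def)
    then show ?thesis using neighbour_sum_nonneg[of U ?f E v] f0 t by (simp add: power_0_left)
  next
    case True
    define l where "l = (LEAST n. v \<in> edge_ball E v0 n)"
    have vl: "v \<in> edge_ball E v0 l" unfolding l_def using True by (rule LeastI_ex)
    have fv: "?f v = \<phi> l" using True by (simp add: radial_def l_def)
    show ?thesis
    proof (cases l)
      case 0
      have "(\<Sum>e\<in>?D. \<phi> 1 ^ (t - 1)) \<le> (\<Sum>e\<in>?D. \<Prod>u\<in>e - {v}. ?f u)"
        by (rule sum_mono) (use far[of _ 0] vl 0 in auto)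
      then show ?thesis using root unfolding ns fv 0 by (simp add: cardD)
    next
      case (Suc i)
      have vi: "v \<notin> edge_ball E v0 i"
        using not_less_Least[of i "\<lambda>n. v \<in> edge_ball E v0 n"] Suc by (simp add: l_def)
      \<comment> \<open>an edge towards the root; one of its vertices has the larger value \<open>\<phi> i\<close>\<close>
      then obtain e w where e: "e \<in> E" "v \<in> e" "w \<in> e" "w \<in> edge_ball E v0 i"
        using vl Suc by auto
      have eD: "e \<in> ?D" using e by auto
      have w: "w \<in> e - {v}" using e vi by auto
      have "(\<Prod>u\<in>e - {v}. ?f u) = ?f w * (\<Prod>u\<in>e - {v} - {w}. ?f u)"
        by (rule prod.remove[OF fin[OF eD] w])
      moreover have "\<phi> (Suc i) ^ card (e - {v} - {w}) \<le> (\<Prod>u\<in>e - {v} - {w}. ?f u)"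
      proof (rule power_card_le_prod[OF nonneg])
        fix u assume "u \<in> e - {v} - {w}"
        then have "u \<in> edge_ball E v0 (Suc i)" using edge_subset_edge_ball[of e E w v0 i] e by auto
        then show "\<phi> (Suc i) \<le> ?f u" by (rule radial_ge[OF anti])
      qed
      moreover have "card (e - {v} - {w}) = t - 2" using card[OF eD] w fin[OF eD] by simp
      moreover have "\<phi> i \<le> ?f w" by (rule radial_ge[OF anti e(4)])
      ultimately have near: "\<phi> i * \<phi> (Suc i) ^ (t - 2) \<le> (\<Prod>u\<in>e - {v}. ?f u)"
        by (auto intro!: mult_mono zero_le_power f0 nonneg)
      have "(\<Sum>e'\<in>?D - {e}. \<phi> (Suc (Suc i)) ^ (t - 1)) \<le> (\<Sum>e'\<in>?D - {e}. \<Prod>u\<in>e' - {v}. ?f u)"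
        by (rule sum_mono) (use far[of _ "Suc i"] vl Suc in auto)
      moreover have "real (card (?D - {e})) = real k - 1"
        using finD eD cardD k by (simp add: of_nat_diff)
      ultimately have "(real k - 1) * \<phi> (Suc (Suc i)) ^ (t - 1)
          \<le> (\<Sum>e'\<in>?D - {e}. \<Prod>u\<in>e' - {v}. ?f u)"
        by simp
      then show ?thesis using level[of i] near
        unfolding ns fv Suc sum.remove[OF finD eD] by linarith
    qed
  qed
qed

section \<open>A radial profile vanishing at finite distance\<close>

text \<open>
  The left-hand side is the minimum of the right-hand side over \<open>r > 0\<close>, attained at \<open>r = 1 / w\<close> for
  \<open>w\<^sup>m\<^sup>+\<^sup>1 = m q\<close>. After rescaling by \<open>w\<close> it is Bernoulli's inequality at \<open>r w\<close>. In the application,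
  \<open>m = t - 1\<close> and \<open>q = k - 1\<close>.
\<close>

lemma critical_value_le:
  fixes m :: nat and q r :: real
  assumes m: "m \<ge> 1" and q: "q > 0" and r: "r > 0"
  shows "real (Suc m) / real m * (real m * q) powr (1 / real (Suc m)) \<le> 1 / r + q * r ^ m"
proof -
  define w where "w = (real m * q) powr (1 / real (Suc m))"
  have mq: "real m * q > 0" using m q by simp
  have w: "w > 0" using m q by (simp add: w_def)
  have wt: "w ^ Suc m = real m * q"
  proof -
    have "w ^ Suc m = w powr real (Suc m)" using w by (simp only: powr_realpow)
    also have "\<dots> = real m * q" unfolding w_def powr_powr using mq m q by simp
    finally show ?thesis .
  qed
  have "1 + real (Suc m) * (r * w - 1) \<le> (1 + (r * w - 1)) ^ Suc m"
    by (rule Bernoulli_inequality) (use r w in \<open>simp add: less_imp_le\<close>)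
  then have "real (Suc m) * (r * w) \<le> real m + r ^ Suc m * (real m * q)"
    unfolding wt[symmetric] by (simp add: power_mult_distrib algebra_simps)
  then have "real (Suc m) * w / real m \<le> 1 / r + q * r ^ m"
    using m r by (simp add: field_simps)
  then show ?thesis by (simp add: w_def)
qed

text \<open>
  The ratios \<open>\<phi> (n + 1) / \<phi> n\<close> of a profile that satisfies the root condition and the level condition
  \<open>c = 1 / r\<^sub>n + q r\<^sub>n\<^sub>+\<^sub>1\<^sup>m\<close> with equality for as long as the latter has a positive solution. Once
  \<open>1 / r\<^sub>n \<ge> c\<close>, the next ratio may be 0. The ratio after a 0 is again 0, and the profile stays 0.
\<close>

primrec profile_ratio :: "nat \<Rightarrow> real \<Rightarrow> real \<Rightarrow> nat \<Rightarrow> real" where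
  "profile_ratio m q c 0 = root m (c / (q + 1))"
| "profile_ratio m q c (Suc n) =
    (if c * profile_ratio m q c n \<le> 1 then 0 else root m ((c - 1 / profile_ratio m q c n) / q))"

text \<open>
  Write \<open>c + q \<delta>\<close> for the critical value. Comparing \<open>q r\<^sub>n\<^sub>+\<^sub>1\<^sup>m = c - 1 / r\<^sub>n\<close> with
  \<open>c + q \<delta> \<le> 1 / r\<^sub>n + q r\<^sub>n\<^sup>m\<close> shows that \<open>r\<^sub>n\<^sup>m\<close> decreases by at least \<open>\<delta>\<close> in each step until the
  recursion stops. It starts at \<open>c / (q + 1) \<le> 1\<close>, which is the critical value inequality at \<open>r = 1\<close>;
  hence all ratios are at most 1 and \<open>\<phi>\<close> is decreasing.
\<close>

lemma vanishing_profile: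
  fixes m :: nat and q c :: real
  assumes m: "m \<ge> 1" and q: "q > 0" and c0: "c > 0"
    and c: "c < real (Suc m) / real m * (real m * q) powr (1 / real (Suc m))"
  obtains \<phi> :: "nat \<Rightarrow> real" and N where "\<phi> 0 = 1" "antimono \<phi>" "\<And>n. \<phi> n \<ge> 0" "\<phi> N = 0"
    "c * \<phi> 0 ^ m \<le> (q + 1) * \<phi> 1 ^ m"
    "\<And>i. c * \<phi> (Suc i) ^ m \<le> \<phi> i * \<phi> (Suc i) ^ (m - 1) + q * \<phi> (Suc (Suc i)) ^ m"
proof -
  define r where "r = profile_ratio m q c"
  define \<delta> where
    "\<delta> = (real (Suc m) / real m * (real m * q) powr (1 / real (Suc m)) - c) / q"
  have \<delta>: "\<delta> > 0" using c q by (simp add: \<delta>_def)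
  have crit: "c + q * \<delta> \<le> 1 / s + q * s ^ m" if "s > 0" for s
    using critical_value_le[OF m q that] q by (simp add: \<delta>_def)
  have r0: "r 0 ^ m = c / (q + 1)" using m c0 q by (simp add: r_def real_root_pow_pos2)
  have stop: "r (Suc n) = 0" if "c * r n \<le> 1" for n using that by (simp add: r_def)
  have rn: "r n \<ge> 0" for n
  proof (induction n)
    case 0
    then show ?case using c0 q by (simp add: r_def real_root_ge_zero)
  next
    case (Suc n)
    show ?case
    proof (cases "c * r n \<le> 1")
      case False
      then have "r n \<noteq> 0" by auto
      then have "r n > 0" using Suc by simp
      then have "c - 1 / r n \<ge> 0" using False by (simp add: field_simps)
      then show ?thesis using False q by (simp add: r_def real_root_ge_zero)
    qed (simp add: stop)
  qed
  have step: "r n > 0" "q * r (Suc n) ^ m = c - 1 / r n" if "\<not> c * r n \<le> 1" for n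
  proof -
    have "r n \<noteq> 0" using that by auto
    then show pos: "r n > 0" using rn[of n] by simp
    then have "c - 1 / r n \<ge> 0" using that by (simp add: field_simps)
    then show "q * r (Suc n) ^ m = c - 1 / r n"
      using that q m by (simp add: r_def real_root_pow_pos2)
  qed
  have decay: "r n = 0 \<or> r n ^ m \<le> 1 - real n * \<delta>" for n
  proof (induction n)
    case 0
    have "c \<le> q + 1" using crit[of 1] mult_pos_pos[OF q \<delta>] by (simp del: zero_less_mult_iff)
    then show ?case using r0 q by simp
  next
    case (Suc n)
    show ?case
    proof (cases "c * r n \<le> 1")
      case False
      have "q * r (Suc n) ^ m \<le> q * (r n ^ m - \<delta>)"
        using crit[OF step(1)[OF False]] step(2)[OF False] by (simp add: algebra_simps)
      then have "r (Suc n) ^ m \<le> r n ^ m - \<delta>" using q by simp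
      then show ?thesis using Suc step(1)[OF False] by (auto simp: algebra_simps)
    qed (simp add: stop)
  qed
  have r1: "r n \<le> 1" for n
  proof (rule ccontr)
    assume "\<not> r n \<le> 1"
    then have "r n \<noteq> 0" "r n ^ m > 1" using m by (auto intro: one_less_power)
    moreover have "real n * \<delta> \<ge> 0" using \<delta> by simp
    ultimately show False using decay[of n] by simp
  qed
  obtain N where "real N * \<delta> > 1" using reals_Archimedean3[OF \<delta>] by blast
  then have rN: "r N = 0" using decay[of N] zero_le_power[OF rn[of N], of m] by auto
  define \<phi> where "\<phi> n = (\<Prod>j<n. r j)" for n
  have \<phi>S: "\<phi> (Suc n) = \<phi> n * r n" for n by (simp add: \<phi>_def)
  have \<phi>0: "\<phi> n \<ge> 0" for n unfolding \<phi>_def by (intro prod_nonneg) (use rn in auto)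
  show thesis
  proof (rule that)
    show "\<phi> 0 = 1" by (simp add: \<phi>_def)
    show "\<phi> n \<ge> 0" for n by (rule \<phi>0)
    show "antimono \<phi>"
      by (rule decseq_SucI) (use \<phi>0 r1 in \<open>simp add: \<phi>S mult_left_le\<close>)
    show "\<phi> (Suc N) = 0" by (simp add: \<phi>S rN)
    show "c * \<phi> 0 ^ m \<le> (q + 1) * \<phi> 1 ^ m" using r0 q by (simp add: \<phi>_def)
    fix i
    obtain m' where m': "m = Suc m'" using m by (cases m) auto
    show "c * \<phi> (Suc i) ^ m \<le> \<phi> i * \<phi> (Suc i) ^ (m - 1) + q * \<phi> (Suc (Suc i)) ^ m"
    proof (cases "c * r i \<le> 1")
      case True
      have "(c * r i) * (\<phi> i * \<phi> (Suc i) ^ m') \<le> 1 * (\<phi> i * \<phi> (Suc i) ^ m')"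
        by (rule mult_right_mono[OF True]) (simp add: \<phi>0)
      then have "c * \<phi> (Suc i) ^ m \<le> \<phi> i * \<phi> (Suc i) ^ m'"
        by (simp add: m' \<phi>S[of i] mult_ac)
      then show ?thesis using q \<phi>0[of "Suc (Suc i)"] by (simp add: m' add_increasing2)
    next
      case False
      have "q * \<phi> (Suc (Suc i)) ^ m = \<phi> (Suc i) ^ m * (q * r (Suc i) ^ m)"
        by (simp add: \<phi>S[of "Suc i"] power_mult_distrib)
      also have "\<dots> = c * \<phi> (Suc i) ^ m - \<phi> (Suc i) ^ m / r i"
        unfolding step(2)[OF False] by (simp add: algebra_simps)
      also have "\<phi> (Suc i) ^ m / r i = \<phi> i * \<phi> (Suc i) ^ m'"
        using step(1)[OF False] by (simp add: m' \<phi>S[of i])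
      finally show ?thesis by (simp add: m')
    qed
  qed
qed

section \<open>The lower bound\<close>

theorem theorem3p3:
  fixes V :: "'a set" and E :: "'a set set" and t k :: nat
  assumes "t \<ge> 2" and "k \<ge> 2"
    and "hypergraph V E"
    and "uniform_hypergraph t E"
    and "regular_hypergraph k V E"
  shows "hypergraph_spectral_radius t V E \<ge>
    ereal (real t / (real t - 1) * ((real t - 1) * (real k - 1)) powr (1 / real t))"
proof (rule ccontr)
  let ?b = "real t / (real t - 1) * ((real t - 1) * (real k - 1)) powr (1 / real t)"
  let ?\<rho> = "hypergraph_spectral_radius t V E"
  \<comment> \<open>a vanishing profile exists only strictly below the bound, hence a value in between\<close>
  assume "\<not> ereal ?b \<le> ?\<rho>"
  moreover have "?b > 0" using assms(1,2) by simp
  ultimately have "max 0 ?\<rho> < ereal ?b" by simp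
  then obtain c where c: "max 0 ?\<rho> < ereal c" "ereal c < ereal ?b"
    using ereal_dense2 by blast
  then have c0: "c > 0" by simp
  have t: "Suc (t - 1) = t" "real (t - 1) = real t - 1" "t - 1 - 1 = t - 2"
    using assms(1) by (auto simp: of_nat_diff)
  have t1: "1 \<le> t - 1" using assms(1) by simp
  obtain \<phi> N where \<phi>: "\<phi> 0 = 1" "antimono \<phi>" "\<And>n. \<phi> n \<ge> 0" "\<phi> N = 0"
    "c * \<phi> 0 ^ (t - 1) \<le> real k * \<phi> 1 ^ (t - 1)"
    "\<And>i. c * \<phi> (Suc i) ^ (t - 1)
        \<le> \<phi> i * \<phi> (Suc i) ^ (t - 2) + (real k - 1) * \<phi> (Suc (Suc i)) ^ (t - 1)"
    using vanishing_profile[OF t1, of "real k - 1" c] assms(2) c0 c(2) unfolding t by auto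
  obtain v where v: "v \<in> V" using hypergraph.nonempty[OF assms(3)] by blast
  have fe: "finite e" if "e \<in> E" for e using uniform_hypergraphD(1)[OF assms(4) that] .
  note ball = edge_ball_finite_subset[OF assms(3) fe v]
  have vball: "v \<in> edge_ball E v n" for n using edge_ball_mono[of 0 n E v] by auto
  have le: "c \<le> finite_spectral_radius t (adjacency_tensor t E) U"
    if U: "edge_ball E v N \<subseteq> U" "U \<subseteq> V" "finite U" for U
  proof (rule finite_spectral_radius_ge_form[OF assms(1,4) U(3)])
    show "radial \<phi> E v u \<ge> 0" for u by (rule radial_nonneg[OF \<phi>(3)])
    show "v \<in> U" using U vball by blast
    have "1 \<le> radial \<phi> E v v" using radial_ge[OF \<phi>(2), of v E v 0] \<phi>(1) by simp
    then show "radial \<phi> E v v > 0" by simp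
    show "c * radial \<phi> E v w ^ (t - 1) \<le> neighbour_sum E U (radial \<phi> E v) w" if "w \<in> U" for w
      by (rule radial_neighbour_sum_ge[OF assms(3,1) _ assms(4,5) \<phi>(2-6) U(1,2) that])
        (use assms(2) in auto)
  qed
  have "ereal c \<le> ?\<rho>"
  proof (cases "finite V")
    case True
    then show ?thesis using le[of V] ball
      by (simp add: hypergraph_spectral_radius_def tensor_spectral_radius_def)
  next
    case False
    let ?U = "edge_ball E v N"
    have "ereal c \<le> ereal (finite_spectral_radius t (adjacency_tensor t E) ?U)"
      using le[of ?U] ball by simp
    also have "\<dots> \<le> ?\<rho>"
      using False ball[of N] vball[of N]
      by (auto simp: hypergraph_spectral_radius_def tensor_spectral_radius_def intro!: SUP_upper)
    finally show ?thesis .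
  qed
  then show False using c(1) by (auto dest: leD)
qed

end
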